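(* Let $(X_i)_{-\infty<i<\infty}$ be a zero-mean purely non-deterministic stationary Gaussian process with $\operatorname{Var}(X_i)=1$, and let $M_n=\max_{1\le i\le n}X_i$. Then $$\frac{M_n}{\sqrt{2\log n}}\longrightarrow 1\quad\text{in probability as } n\to\infty .$$
   Context: A zero-mean stationary Gaussian process $(X_i)_{-\infty<i<\infty}$ is purely non-deterministic if it can be expressed in terms of its innovations $Z_i=X_i-\mathbb{E}(X_i\mid X_{i-1},X_{i-2},\dots)$, which are i.i.d. (Gaussian), as $X_i=Z_i+\sum_{j=1}^{\infty}\psi_jZ_{i-j}$ for real constants $\psi_j$. *)

theory Defs
  imports "HOL-Probability.Probability"
begin

(* Normal laws include the degenerate ones (variance 0); otherwise no process would be Gaussian,
   since the zero linear combination is constant. *)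
definition gaussian_rv :: "'a measure \<Rightarrow> ('a \<Rightarrow> real) \<Rightarrow> bool" where
  "gaussian_rv M Y \<longleftrightarrow> Y \<in> borel_measurable M \<and>
     ((\<exists>\<mu> \<sigma>. \<sigma> > 0 \<and> distributed M lborel Y (\<lambda>x. ennreal (normal_density \<mu> \<sigma> x))) \<or>
      (\<exists>\<mu>. AE \<omega> in M. Y \<omega> = \<mu>))"

definition gaussian_process :: "'a measure \<Rightarrow> (int \<Rightarrow> 'a \<Rightarrow> real) \<Rightarrow> bool" where
  "gaussian_process M X \<longleftrightarrow>
     (\<forall>I a. finite I \<longrightarrow> gaussian_rv M (\<lambda>\<omega>. \<Sum>i\<in>I. a i * X i \<omega>))"

definition stationary_process :: "'a measure \<Rightarrow> (int \<Rightarrow> 'a \<Rightarrow> real) \<Rightarrow> bool" where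
  "stationary_process M X \<longleftrightarrow>
     (\<forall>i. X i \<in> borel_measurable M) \<and>
     (\<forall>I h. finite I \<longrightarrow>
        distr M (\<Pi>\<^sub>M i\<in>I. borel) (\<lambda>\<omega>. \<lambda>i\<in>I. X (i + h) \<omega>) =
        distr M (\<Pi>\<^sub>M i\<in>I. borel) (\<lambda>\<omega>. \<lambda>i\<in>I. X i \<omega>))"

definition strict_past :: "'a measure \<Rightarrow> (int \<Rightarrow> 'a \<Rightarrow> real) \<Rightarrow> int \<Rightarrow> 'a measure" where
  "strict_past M X i =
     sigma (space M) (\<Union>j\<in>{..<i}. {X j -` A \<inter> space M | A. A \<in> sets borel})"

(* The library's conditional expectation is only meaningful for sub-sigma-algebras of M. *)
lemma subalgebra_strict_past:
  assumes "\<And>j. X j \<in> borel_measurable M"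
  shows "subalgebra M (strict_past M X i)"
proof -
  have "(\<Union>j\<in>{..<i}. {X j -` A \<inter> space M | A. A \<in> sets borel}) \<subseteq> sets M"
    using assms by (auto intro: measurable_sets)
  then show ?thesis
    unfolding subalgebra_def strict_past_def
    by (simp add: sets.sigma_sets_subset sets_measure_of_conv space_measure_of_conv)
qed

definition innovation :: "'a measure \<Rightarrow> (int \<Rightarrow> 'a \<Rightarrow> real) \<Rightarrow> int \<Rightarrow> 'a \<Rightarrow> real" where
  "innovation M X i = (\<lambda>\<omega>. X i \<omega> - real_cond_exp M (strict_past M X i) (X i) \<omega>)"

(* The infinite sum is a limit in mean square.  The nonnegative integral is used because the
   Bochner integral of a non-integrable function would be 0. *)
definition purely_nondeterministic :: "'a measure \<Rightarrow> (int \<Rightarrow> 'a \<Rightarrow> real) \<Rightarrow> bool" where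
  "purely_nondeterministic M X \<longleftrightarrow>
     (let Z = innovation M X in
        prob_space.indep_vars M (\<lambda>_. borel) Z UNIV \<and>
        (\<forall>i. distr M borel (Z i) = distr M borel (Z 0)) \<and>
        (\<forall>i. gaussian_rv M (Z i)) \<and>
        (\<exists>\<psi> :: nat \<Rightarrow> real. \<forall>i.
           (\<lambda>m. \<integral>\<^sup>+ \<omega>. ennreal ((X i \<omega> - (Z i \<omega> + (\<Sum>j=1..m. \<psi> j * Z (i - int j) \<omega>)))\<^sup>2) \<partial>M)
             \<longlonglongrightarrow> 0))"

definition converges_in_probability ::
    "'a measure \<Rightarrow> (nat \<Rightarrow> 'a \<Rightarrow> real) \<Rightarrow> ('a \<Rightarrow> real) \<Rightarrow> bool" where
  "converges_in_probability M Y L \<longleftrightarrow>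
     (\<forall>n. Y n \<in> borel_measurable M) \<and> L \<in> borel_measurable M \<and>
     (\<forall>\<epsilon>>0. (\<lambda>n. measure M {\<omega> \<in> space M. \<bar>Y n \<omega> - L \<omega>\<bar> > \<epsilon>}) \<longlonglongrightarrow> 0)"

(* Only meaningful for n \<ge> 1. *)
definition running_max :: "(int \<Rightarrow> 'a \<Rightarrow> real) \<Rightarrow> nat \<Rightarrow> 'a \<Rightarrow> real" where
  "running_max X n \<omega> = Max ((\<lambda>i. X i \<omega>) ` {1..int n})"

end

(*
  Truncate the moving average after m terms, X_i = Y_i + R_i.  The truncation is m-dependent, so
  the variables Y_{(m+1)q}, q <= n/(m+1), are i.i.d. centered normal with variance close to 1, and
  their maximum exceeds (1 - e/2) sqrt(2 log n) with high probability.  The remainders R_i are mean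
  square limits of centered Gaussian sums of small variance; such limits keep a Gaussian tail bound,
  so a union bound gives max |R_i| <= (e/2) sqrt(2 log n), whatever the dependence.
  The upper bound for the maximum of the X_i is a union bound too.
*)
theory Submission
  imports Defs "HOL-Real_Asymp.Real_Asymp"
begin

text \<open>A union bound over n indices needs tails of size o(1/n) at a height of order sqrt(log
  n). Chebyshev's inequality for a remainder of small variance gives only order 1/log n, so Gaussian
  decay must be carried through the limit, although the remainder is known only by mean-square
  convergence and not by a density. The Gaussian bound is therefore applied to the finite sums
  between m and N, whose variances are bounded uniformly in N, and Chebyshev is spent only on the
  error at N, which vanishes as N grows while the level stays fixed. The order m depends on e alone.
  Keeping every (m+1)-th index thus costs a constant factor in the number of independent trials,
  while the expected number of exceedances grows roughly like n^(1 - b^2) with b < 1. Subpolynomial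
  factors are immaterial, so crude normal tail estimates suffice.\<close>

section \<open>Tails of a centered normal law\<close>

lemma (in prob_space) normal_upper_tail:
  assumes Y: "distributed M lborel Y (normal_density 0 s)" and s: "s > 0" and t: "t \<ge> 0"
  shows "prob {\<omega> \<in> space M. Y \<omega> > t} \<le> exp (- t\<^sup>2 / (2 * s\<^sup>2))"
proof -
  \<comment> \<open>Recentring the density at \<open>t\<close> pulls out the whole decay factor.\<close>
  have dens: "normal_density 0 s x * indicator {t<..} x \<le> exp (- t\<^sup>2 / (2 * s\<^sup>2)) * normal_density t s x" for x
  proof (cases "x > t")
    case True
    have "t\<^sup>2 + (x - t)\<^sup>2 \<le> x\<^sup>2"
      using mult_left_mono[of t x t] t True by (simp add: power2_eq_square algebra_simps)
    then have "- x\<^sup>2 / (2 * s\<^sup>2) \<le> - t\<^sup>2 / (2 * s\<^sup>2) + - (x - t)\<^sup>2 / (2 * s\<^sup>2)"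
      unfolding add_divide_distrib[symmetric] by (intro divide_right_mono) auto
    then have "exp (- x\<^sup>2 / (2 * s\<^sup>2)) \<le> exp (- t\<^sup>2 / (2 * s\<^sup>2)) * exp (- (x - t)\<^sup>2 / (2 * s\<^sup>2))"
      by (metis exp_add exp_le_cancel_iff)
    with True s show ?thesis
      by (simp add: normal_density_def divide_right_mono)
  qed simp
  have "emeasure M (Y -` {t<..} \<inter> space M)
      = (\<integral>\<^sup>+x. ennreal (normal_density 0 s x) * indicator {t<..} x \<partial>lborel)"
    by (rule distributed_emeasure[OF Y]) simp
  also have "\<dots> \<le> (\<integral>\<^sup>+x. ennreal (exp (- t\<^sup>2 / (2 * s\<^sup>2))) * ennreal (normal_density t s x) \<partial>lborel)"
  proof (intro nn_integral_mono)
    fix x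
    show "ennreal (normal_density 0 s x) * indicator {t<..} x
        \<le> ennreal (exp (- t\<^sup>2 / (2 * s\<^sup>2))) * ennreal (normal_density t s x)"
      using ennreal_leI[OF dens[of x]] by (cases "x > t") (simp_all add: ennreal_mult)
  qed
  also have "\<dots> = ennreal (exp (- t\<^sup>2 / (2 * s\<^sup>2))) * (\<integral>\<^sup>+x. ennreal (normal_density t s x) \<partial>lborel)"
    by (intro nn_integral_cmult) auto
  also have "(\<integral>\<^sup>+x. ennreal (normal_density t s x) \<partial>lborel) = 1"
    using s by (subst nn_integral_eq_integral) auto
  finally have "emeasure M (Y -` {t<..} \<inter> space M) \<le> ennreal (exp (- t\<^sup>2 / (2 * s\<^sup>2)))"
    by simp
  then have "prob (Y -` {t<..} \<inter> space M) \<le> exp (- t\<^sup>2 / (2 * s\<^sup>2))"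
    by (simp add: emeasure_eq_measure)
  also have "Y -` {t<..} \<inter> space M = {\<omega> \<in> space M. Y \<omega> > t}" by auto
  finally show ?thesis .
qed

lemma (in prob_space) normal_abs_tail:
  assumes Y: "distributed M lborel Y (normal_density 0 s)" and s: "s > 0" and t: "t \<ge> 0"
  shows "prob {\<omega> \<in> space M. \<bar>Y \<omega>\<bar> > t} \<le> 2 * exp (- t\<^sup>2 / (2 * s\<^sup>2))"
proof -
  have [measurable]: "Y \<in> borel_measurable M"
    using distributed_measurable[OF Y] by simp
  have "distributed M lborel (\<lambda>\<omega>. 0 + (-1) * Y \<omega>) (normal_density (0 + (-1) * 0) (\<bar>-1\<bar> * s))"
    by (rule normal_density_affine[OF Y s]) simp
  then have Y': "distributed M lborel (\<lambda>\<omega>. - Y \<omega>) (normal_density 0 s)" by simp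
  have "prob {\<omega> \<in> space M. \<bar>Y \<omega>\<bar> > t}
      \<le> prob ({\<omega> \<in> space M. Y \<omega> > t} \<union> {\<omega> \<in> space M. - Y \<omega> > t})"
    by (intro finite_measure_mono) auto
  also have "\<dots> \<le> prob {\<omega> \<in> space M. Y \<omega> > t} + prob {\<omega> \<in> space M. - Y \<omega> > t}"
    by (intro measure_Un_le) auto
  also have "\<dots> \<le> exp (- t\<^sup>2 / (2 * s\<^sup>2)) + exp (- t\<^sup>2 / (2 * s\<^sup>2))"
    by (intro add_mono normal_upper_tail Y Y' s t)
  finally show ?thesis by simp
qed

text \<open>The density decreases on the unit interval to the right of \<open>t\<close>, so its
  value at the right end bounds the mass there. At \<open>t\<close> of order sqrt(log n) this loses
  only a factor exp(O(sqrt(log n))), less than any power of n.\<close>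

lemma (in prob_space) normal_lower_tail:
  assumes Y: "distributed M lborel Y (normal_density 0 s)" and s: "s > 0" and t: "t \<ge> 0"
  shows "prob {\<omega> \<in> space M. Y \<omega> > t} \<ge> normal_density 0 s (t + 1)"
proof -
  have "ennreal (normal_density 0 s (t + 1)) = 
      (\<integral>\<^sup>+x. ennreal (normal_density 0 s (t + 1)) * indicator {t<..t + 1} x \<partial>lborel)"
    by (simp add: nn_integral_cmult_indicator)
  also have "\<dots> \<le> (\<integral>\<^sup>+x. ennreal (normal_density 0 s x) * indicator {t<..} x \<partial>lborel)"
  proof (intro nn_integral_mono)
    fix x
    have "normal_density 0 s (t + 1) \<le> normal_density 0 s x" if "t < x" "x \<le> t + 1"
      using that t s unfolding normal_density_def
      by (intro mult_left_mono iffD2[OF exp_le_cancel_iff] divide_right_mono) auto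
    then show "ennreal (normal_density 0 s (t + 1)) * indicator {t<..t + 1} x
        \<le> ennreal (normal_density 0 s x) * indicator {t<..} x"
      by (auto simp: indicator_def intro: ennreal_leI)
  qed
  also have "\<dots> = emeasure M (Y -` {t<..} \<inter> space M)"
    by (rule distributed_emeasure[OF Y, symmetric]) simp
  also have "Y -` {t<..} \<inter> space M = {\<omega> \<in> space M. Y \<omega> > t}" by auto
  finally show ?thesis by (simp add: emeasure_eq_measure)
qed

section \<open>Finite families of events: union bound and independence\<close>

lemma (in prob_space) prob_Bex_le:
  assumes "finite I" "\<And>i. i \<in> I \<Longrightarrow> {\<omega> \<in> space M. P i \<omega>} \<in> events"
    and "\<And>i. i \<in> I \<Longrightarrow> prob {\<omega> \<in> space M. P i \<omega>} \<le> p"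
  shows "prob {\<omega> \<in> space M. \<exists>i\<in>I. P i \<omega>} \<le> real (card I) * p"
proof -
  have "{\<omega> \<in> space M. \<exists>i\<in>I. P i \<omega>} = (\<Union>i\<in>I. {\<omega> \<in> space M. P i \<omega>})" by auto
  also have "prob \<dots> \<le> (\<Sum>i\<in>I. prob {\<omega> \<in> space M. P i \<omega>})"
    using assms by (intro finite_measure_subadditive_finite) auto
  also have "\<dots> \<le> real (card I) * p"
    using assms(3) by (rule sum_bounded_above)
  finally show ?thesis .
qed

text \<open>Independence gives a product of factors at most \<open>1 - p\<close>, and
  \<open>1 - p \<le> exp (- p)\<close>. With this form it is enough that \<open>p * card I\<close>
  tends to infinity. The empty family is included since the number of blocks may be 0 for small
  n.\<close>

lemma (in prob_space) prob_Ball_le_indep: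
  fixes W :: "'i \<Rightarrow> 'a \<Rightarrow> real"
  assumes W: "indep_vars (\<lambda>_. borel) W I" and I: "finite I"
    and p: "\<And>i. i \<in> I \<Longrightarrow> prob {\<omega> \<in> space M. W i \<omega> > t} \<ge> p"
  shows "prob {\<omega> \<in> space M. \<forall>i\<in>I. W i \<omega> \<le> t} \<le> exp (- p * card I)"
proof (cases "I = {}")
  case False
  have Wm: "W i \<in> borel_measurable M" if "i \<in> I" for i
    using W that by (auto simp: indep_vars_def)
  have "{\<omega> \<in> space M. \<forall>i\<in>I. W i \<omega> \<le> t} = (\<Inter>i\<in>I. W i -` {..t} \<inter> space M)"
    using False by auto
  also have "prob \<dots> = (\<Prod>i\<in>I. prob (W i -` {..t} \<inter> space M))"
    by (rule indep_varsD_finite[OF W False I]) auto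
  also have "\<dots> \<le> (\<Prod>i\<in>I. exp (- p))"
  proof (intro prod_mono conjI)
    fix i assume i: "i \<in> I"
    note [measurable] = Wm[OF i]
    have "W i -` {..t} \<inter> space M = space M - {\<omega> \<in> space M. W i \<omega> > t}" by auto
    then have "prob (W i -` {..t} \<inter> space M) = 1 - prob {\<omega> \<in> space M. W i \<omega> > t}"
      by (simp add: prob_compl)
    also have "\<dots> \<le> 1 + - p" using p[OF i] by simp
    also have "\<dots> \<le> exp (- p)" by (rule exp_ge_add_one_self)
    finally show "prob (W i -` {..t} \<inter> space M) \<le> exp (- p)" .
  qed simp
  also have "\<dots> = exp (- p * card I)"
    by (simp add: exp_of_nat_mult[symmetric] mult.commute)
  finally show ?thesis .
qed simp

section \<open>Growth rates at the scale sqrt(2 log n)\<close>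

text \<open>The square of the scale is \<open>2 * ln n\<close>, so the expression is a disguised
  \<open>n powr (1 - c)\<close>: the factor \<open>n\<close> comes from a union bound, and
  \<open>c > 1\<close> is the margin that beats it.\<close>

lemma upper_rate:
  fixes c :: real
  assumes "c > 1"
  shows "(\<lambda>n::nat. real n * exp (- (c * (sqrt (2 * ln (real n)))\<^sup>2 / 2))) \<longlonglongrightarrow> 0"
proof -
  have "1 - c < 0" using assms by simp
  then have *: "(\<lambda>n::nat. real n powr (1 - c)) \<longlonglongrightarrow> 0"
    by real_asymp
  show ?thesis
  proof (rule Lim_transform_eventually[OF *])
    show "\<forall>\<^sub>F n in sequentially. real n powr (1 - c) = real n * exp (- (c * (sqrt (2 * ln (real n)))\<^sup>2 / 2))"
      using eventually_gt_at_top[of 0]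
    proof eventually_elim
      case (elim n)
      then have "real n powr (1 - c) = exp (ln (real n) + - (c * ln (real n)))"
        by (simp add: powr_def algebra_simps)
      also have "\<dots> = real n * exp (- (c * ln (real n)))"
        using elim by (simp only: exp_add exp_ln of_nat_0_less_iff)
      finally show ?case using elim by simp
    qed
  qed
qed

text \<open>Writing L for the scale and b for a/s, expanding the square leaves the exponent (1 -
  b^2) ln n - (a/s^2) L - 1/(2 s^2). Its first term dominates because L is only of order sqrt(ln n).
  The factor \<open>d\<close> will be the proportion of indices kept as independent blocks.\<close>

lemma lower_rate:
  fixes a s d :: real
  assumes a: "0 < a" "a < s" and d: "0 < d"
  shows "filterlim (\<lambda>n::nat. real n * d * normal_density 0 s (a * sqrt (2 * ln (real n)) + 1)) at_top sequentially"
proof -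
  define b where "b = a / s"
  have b: "0 < b" "b < 1" using a by (auto simp: b_def)
  then have b2: "1 - b\<^sup>2 > 0" by (simp add: power_less_one_iff)
  have "filterlim (\<lambda>n::nat. (1 - b\<^sup>2) * ln (real n) - (a / s\<^sup>2) * sqrt (2 * ln (real n)) - 1 / (2 * s\<^sup>2)) at_top sequentially"
    using b2 a by real_asymp
  then have "filterlim (\<lambda>n::nat. exp ((1 - b\<^sup>2) * ln (real n) - (a / s\<^sup>2) * sqrt (2 * ln (real n)) - 1 / (2 * s\<^sup>2))) at_top sequentially"
    by (rule filterlim_compose[OF exp_at_top])
  then have *: "filterlim (\<lambda>n::nat. d / sqrt (2 * pi * s\<^sup>2) * exp ((1 - b\<^sup>2) * ln (real n) - (a / s\<^sup>2) * sqrt (2 * ln (real n)) - 1 / (2 * s\<^sup>2))) at_top sequentially"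
    using d a by (intro filterlim_tendsto_pos_mult_at_top[OF tendsto_const]) auto
  show ?thesis
  proof (rule filterlim_mono_eventually[OF * order_refl order_refl])
    show "\<forall>\<^sub>F n in sequentially. d / sqrt (2 * pi * s\<^sup>2) * exp ((1 - b\<^sup>2) * ln (real n) - (a / s\<^sup>2) * sqrt (2 * ln (real n)) - 1 / (2 * s\<^sup>2))
       = real n * d * normal_density 0 s (a * sqrt (2 * ln (real n)) + 1)"
      using eventually_gt_at_top[of 0]
    proof eventually_elim
      case (elim n)
      define L where "L = sqrt (2 * ln (real n))"
      have L: "ln (real n) = L\<^sup>2 / 2" using elim by (simp add: L_def)
      have "(1 - b\<^sup>2) * ln (real n) - (a / s\<^sup>2) * L - 1 / (2 * s\<^sup>2)
          = ln (real n) + - (a * L + 1 - 0)\<^sup>2 / (2 * s\<^sup>2)"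
        using a unfolding b_def L by (simp add: field_simps power2_eq_square)
      then have "exp ((1 - b\<^sup>2) * ln (real n) - (a / s\<^sup>2) * L - 1 / (2 * s\<^sup>2))
          = real n * exp (- (a * L + 1 - 0)\<^sup>2 / (2 * s\<^sup>2))"
        using elim by (simp only: exp_add exp_ln of_nat_0_less_iff)
      then show ?case
        unfolding L_def[symmetric] normal_density_def by simp
    qed
  qed
qed

section \<open>Moving sums of independent normal variables\<close>

lemma (in prob_space) normal_second_moment:
  assumes Y: "distributed M lborel Y (normal_density 0 s)" and s: "s > 0"
  shows "integrable M (\<lambda>\<omega>. (Y \<omega>)\<^sup>2)" "expectation (\<lambda>\<omega>. (Y \<omega>)\<^sup>2) = s\<^sup>2"
proof -
  have "integrable lborel (\<lambda>x. normal_density 0 s x * x\<^sup>2)"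
    using integrable_normal_moment[OF s, of 0 2] by simp
  then show "integrable M (\<lambda>\<omega>. (Y \<omega>)\<^sup>2)"
    by (subst (asm) distributed_integrable[OF Y]) auto
  show "expectation (\<lambda>\<omega>. (Y \<omega>)\<^sup>2) = s\<^sup>2"
    using normal_distributed_variance[OF s Y] normal_distributed_expectation[OF s Y] by simp
qed

text \<open>Each sum is a measurable function of the restriction of \<open>Z\<close> to its own
  window of indices, and disjoint windows are independent. Singleton windows give independence of
  the terms within one sum; windows of length m + 1 give independence of distant
  truncations.\<close>

lemma (in prob_space) indep_vars_shifted_sums:
  fixes Z :: "int \<Rightarrow> 'a \<Rightarrow> real"
  assumes Z: "indep_vars (\<lambda>_. borel) Z UNIV"
    and disj: "disjoint_family_on (\<lambda>q. (\<lambda>j. g q - int j) ` J q) L"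
  shows "indep_vars (\<lambda>_. borel) (\<lambda>q \<omega>. \<Sum>j\<in>J q. \<psi> j * Z (g q - int j) \<omega>) L"
proof -
  let ?K = "\<lambda>q. (\<lambda>j. g q - int j) ` J q"
  have "indep_vars (\<lambda>q. PiM (?K q) (\<lambda>_. borel)) (\<lambda>q \<omega>. restrict (\<lambda>i. Z i \<omega>) (?K q)) L"
    using disj by (intro indep_vars_restrict[OF Z]) auto
  then have "indep_vars (\<lambda>_. borel)
      (\<lambda>q \<omega>. (\<lambda>f. \<Sum>j\<in>J q. \<psi> j * f (g q - int j)) (restrict (\<lambda>i. Z i \<omega>) (?K q))) L"
  proof (rule indep_vars_compose2)
    fix q
    show "(\<lambda>f. \<Sum>j\<in>J q. \<psi> j * f (g q - int j)) \<in> borel_measurable (PiM (?K q) (\<lambda>_. borel))"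
      by (intro borel_measurable_sum borel_measurable_times borel_measurable_const
          measurable_component_singleton) auto
  qed
  then show ?thesis by simp
qed

lemma (in prob_space) moving_sum_normal:
  fixes Z :: "int \<Rightarrow> 'a \<Rightarrow> real"
  assumes Z: "indep_vars (\<lambda>_. borel) Z UNIV"
    and n: "\<And>i. distributed M lborel (Z i) (normal_density 0 s)" and s: "s > 0"
    and J: "finite J" "\<exists>j\<in>J. \<psi> j \<noteq> 0"
  shows "distributed M lborel (\<lambda>\<omega>. \<Sum>j\<in>J. \<psi> j * Z (i - int j) \<omega>)
           (normal_density 0 (sqrt (s\<^sup>2 * (\<Sum>j\<in>J. (\<psi> j)\<^sup>2))))"
proof -
  \<comment> \<open>A term with coefficient 0 is constant and has no density, so it must be dropped
    before normal laws are added.\<close>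
  define J' where "J' = {j\<in>J. \<psi> j \<noteq> 0}"
  have J': "finite J'" "J' \<noteq> {}" "J' \<subseteq> J" using J by (auto simp: J'_def)
  have "indep_vars (\<lambda>_. borel) (\<lambda>q \<omega>. \<Sum>j\<in>{q}. \<psi> j * Z (i - int j) \<omega>) J'"
    by (rule indep_vars_shifted_sums[OF Z]) (auto simp: disjoint_family_on_def)
  then have ind: "indep_vars (\<lambda>_. borel) (\<lambda>q \<omega>. \<psi> q * Z (i - int q) \<omega>) J'" by simp
  have "distributed M lborel (\<lambda>\<omega>. \<Sum>j\<in>J'. \<psi> j * Z (i - int j) \<omega>)
      (normal_density (\<Sum>j\<in>J'. 0) (sqrt (\<Sum>j\<in>J'. (\<bar>\<psi> j\<bar> * s)\<^sup>2)))"
  proof (rule sum_indep_normal[OF J'(1,2) ind])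
    fix j assume j: "j \<in> J'"
    then show "0 < \<bar>\<psi> j\<bar> * s" using s by (simp add: J'_def)
    have "distributed M lborel (\<lambda>\<omega>. 0 + \<psi> j * Z (i - int j) \<omega>)
        (normal_density (0 + \<psi> j * 0) (\<bar>\<psi> j\<bar> * s))"
      using j by (intro normal_density_affine n s) (simp add: J'_def)
    then show "distributed M lborel (\<lambda>\<omega>. \<psi> j * Z (i - int j) \<omega>) (normal_density 0 (\<bar>\<psi> j\<bar> * s))"
      by simp
  qed
  moreover have "(\<Sum>j\<in>J'. (\<bar>\<psi> j\<bar> * s)\<^sup>2) = s\<^sup>2 * (\<Sum>j\<in>J. (\<psi> j)\<^sup>2)"
  proof -
    have "(\<Sum>j\<in>J'. (\<psi> j)\<^sup>2) = (\<Sum>j\<in>J. (\<psi> j)\<^sup>2)"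
      using J by (intro sum.mono_neutral_left) (auto simp: J'_def)
    then show ?thesis by (simp add: power_mult_distrib sum_distrib_right[symmetric] mult.commute[of _ "s\<^sup>2"] sum_distrib_left[symmetric])
  qed
  moreover have "(\<Sum>j\<in>J'. \<psi> j * Z (i - int j) \<omega>) = (\<Sum>j\<in>J. \<psi> j * Z (i - int j) \<omega>)" for \<omega>
    using J by (intro sum.mono_neutral_left) (auto simp: J'_def)
  ultimately show ?thesis by simp
qed

text \<open>Bounding the variance by \<open>\<delta>\<close> instead of naming it lets the statement
  cover sums whose coefficients all vanish, as happens beyond the order of a finite moving average.
  For \<open>\<delta> = 0\<close> the division by zero makes the bound equal to 2, which is
  harmless.\<close>

lemma (in prob_space) moving_sum_abs_tail:
  fixes Z :: "int \<Rightarrow> 'a \<Rightarrow> real"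
  assumes Z: "indep_vars (\<lambda>_. borel) Z UNIV"
    and n: "\<And>i. distributed M lborel (Z i) (normal_density 0 s)" and s: "s > 0"
    and J: "finite J" and d: "s\<^sup>2 * (\<Sum>j\<in>J. (\<psi> j)\<^sup>2) \<le> \<delta>" and t: "t \<ge> 0"
  shows "prob {\<omega> \<in> space M. \<bar>\<Sum>j\<in>J. \<psi> j * Z (i - int j) \<omega>\<bar> > t} \<le> 2 * exp (- t\<^sup>2 / (2 * \<delta>))"
proof (cases "\<exists>j\<in>J. \<psi> j \<noteq> 0")
  case True
  then have pos: "s\<^sup>2 * (\<Sum>j\<in>J. (\<psi> j)\<^sup>2) > 0"
    using J s by (intro mult_pos_pos) (auto intro: sum_pos2)
  have "prob {\<omega> \<in> space M. \<bar>\<Sum>j\<in>J. \<psi> j * Z (i - int j) \<omega>\<bar> > t}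
      \<le> 2 * exp (- t\<^sup>2 / (2 * (sqrt (s\<^sup>2 * (\<Sum>j\<in>J. (\<psi> j)\<^sup>2)))\<^sup>2))"
    using pos by (intro normal_abs_tail[OF moving_sum_normal[OF Z n s J True] _ t]) simp
  also have "(sqrt (s\<^sup>2 * (\<Sum>j\<in>J. (\<psi> j)\<^sup>2)))\<^sup>2 = s\<^sup>2 * (\<Sum>j\<in>J. (\<psi> j)\<^sup>2)"
    using pos by (intro real_sqrt_pow2) simp
  also have "2 * exp (- t\<^sup>2 / (2 * (s\<^sup>2 * (\<Sum>j\<in>J. (\<psi> j)\<^sup>2)))) \<le> 2 * exp (- t\<^sup>2 / (2 * \<delta>))"
    using pos d by (simp add: frac_le)
  finally show ?thesis .
next
  case False
  then have "(\<Sum>j\<in>J. \<psi> j * Z (i - int j) \<omega>) = 0" for \<omega> by (intro sum.neutral) auto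
  then show ?thesis using t by (simp add: not_less[symmetric])
qed

section \<open>The linear process, its truncations and their variances\<close>

text \<open>The innovation at time \<open>i\<close> is the term of index 0 of the sum. The
  assumption \<open>psi_0\<close> makes every truncation nondegenerate, so that it has a normal
  density.\<close>

locale gaussian_linear_process = prob_space +
  fixes X Z :: "int \<Rightarrow> 'a \<Rightarrow> real" and \<psi> :: "nat \<Rightarrow> real" and s :: real
  assumes indep_Z: "indep_vars (\<lambda>_. borel) Z UNIV"
    and normal_Z: "distributed M lborel (Z i) (normal_density 0 s)"
    and s_pos: "s > 0"
    and normal_X: "distributed M lborel (X i) std_normal_density"
    and psi_0: "\<psi> 0 \<noteq> 0"
    and mean_square_limit:
      "(\<lambda>m. \<integral>\<^sup>+ \<omega>. ennreal ((X i \<omega> - (\<Sum>j\<le>m. \<psi> j * Z (i - int j) \<omega>))\<^sup>2) \<partial>M) \<longlonglongrightarrow> 0"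
begin

definition trunc :: "nat \<Rightarrow> int \<Rightarrow> 'a \<Rightarrow> real" where
  "trunc m i \<omega> = (\<Sum>j\<le>m. \<psi> j * Z (i - int j) \<omega>)"

definition trunc_var :: "nat \<Rightarrow> real" where
  "trunc_var m = s\<^sup>2 * (\<Sum>j\<le>m. (\<psi> j)\<^sup>2)"

lemma measurable_XZ [measurable]: "X i \<in> borel_measurable M" "Z i \<in> borel_measurable M"
  using distributed_measurable[OF normal_X] distributed_measurable[OF normal_Z] by auto

lemma measurable_trunc [measurable]: "trunc m i \<in> borel_measurable M"
  unfolding trunc_def[abs_def] by measurable

lemma trunc_var_pos: "trunc_var m > 0"
  unfolding trunc_var_def using s_pos psi_0
  by (intro mult_pos_pos sum_pos2[of _ 0]) auto

lemma normal_trunc: "distributed M lborel (trunc m i) (normal_density 0 (sqrt (trunc_var m)))"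
  unfolding trunc_def[abs_def] trunc_var_def
  using psi_0 by (intro moving_sum_normal indep_Z normal_Z s_pos) auto

lemma trunc_second_moment:
  "integrable M (\<lambda>\<omega>. (trunc m i \<omega>)\<^sup>2)" "expectation (\<lambda>\<omega>. (trunc m i \<omega>)\<^sup>2) = trunc_var m"
  using normal_second_moment[OF normal_trunc] trunc_var_pos[of m] by auto

lemma X_second_moment: "integrable M (\<lambda>\<omega>. (X i \<omega>)\<^sup>2)" "expectation (\<lambda>\<omega>. (X i \<omega>)\<^sup>2) = 1"
  using normal_second_moment[OF normal_X] by auto

lemma integrable_remainder: "integrable M (\<lambda>\<omega>. (X i \<omega> - trunc m i \<omega>)\<^sup>2)"
proof (rule Bochner_Integration.integrable_bound)
  show "integrable M (\<lambda>\<omega>. 2 * (X i \<omega>)\<^sup>2 + 2 * (trunc m i \<omega>)\<^sup>2)"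
    by (intro Bochner_Integration.integrable_add integrable_mult_right X_second_moment trunc_second_moment)
  have "(x - y)\<^sup>2 \<le> 2 * x\<^sup>2 + 2 * y\<^sup>2" for x y :: real
    using zero_le_power2[of "x + y"] unfolding power2_sum power2_diff by linarith
  then show "AE \<omega> in M. norm ((X i \<omega> - trunc m i \<omega>)\<^sup>2) \<le> norm (2 * (X i \<omega>)\<^sup>2 + 2 * (trunc m i \<omega>)\<^sup>2)"
    by simp
qed simp

definition err :: "nat \<Rightarrow> int \<Rightarrow> real" where
  "err m i = expectation (\<lambda>\<omega>. (X i \<omega> - trunc m i \<omega>)\<^sup>2)"

lemma err_tendsto: "(\<lambda>m. err m i) \<longlonglongrightarrow> 0"
proof (rule tendsto_ennrealD)
  have "ennreal (err m i) = (\<integral>\<^sup>+ \<omega>. ennreal ((X i \<omega> - trunc m i \<omega>)\<^sup>2) \<partial>M)" for m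
    unfolding err_def by (intro nn_integral_eq_integral[symmetric] integrable_remainder) auto
  then show "(\<lambda>m. ennreal (err m i)) \<longlonglongrightarrow> ennreal 0"
    using mean_square_limit[of i] by (simp add: trunc_def)
qed (auto simp: err_def)

text \<open>With D = X - T for the truncation T, T^2 - X^2 = D^2 - 2 X D, and weighted AM-GM gives 2
  |X D| \<le> \<eta> X^2 + D^2/\<eta>. Taking expectations with E X^2 = 1 gives the bound. The
  weight \<open>\<eta>\<close> is fixed before \<open>m\<close>, so the factor of \<open>err\<close>
  stays constant as \<open>m\<close> grows.\<close>

lemma trunc_var_deviation:
  assumes "\<eta> > 0"
  shows "\<bar>trunc_var m - 1\<bar> \<le> \<eta> + err m 0 * (1 / \<eta> + 1)"
proof -
  define D where "D \<omega> = X 0 \<omega> - trunc m 0 \<omega>" for \<omega>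
  define B where "B \<omega> = \<eta> * (X 0 \<omega>)\<^sup>2 + (1 / \<eta> + 1) * (D \<omega>)\<^sup>2" for \<omega>
  have D: "integrable M (\<lambda>\<omega>. (D \<omega>)\<^sup>2)" "expectation (\<lambda>\<omega>. (D \<omega>)\<^sup>2) = err m 0"
    using integrable_remainder by (auto simp: D_def err_def)
  have B: "integrable M B" "expectation B = \<eta> + err m 0 * (1 / \<eta> + 1)"
    unfolding B_def using D X_second_moment by (simp_all)
  have pt: "\<bar>(trunc m 0 \<omega>)\<^sup>2 - (X 0 \<omega>)\<^sup>2\<bar> \<le> B \<omega>" for \<omega>
  proof -
    have "2 * \<bar>x * d\<bar> \<le> \<eta> * x\<^sup>2 + d\<^sup>2 / \<eta>" for x d :: real
    proof -
      have "0 \<le> (\<eta> * \<bar>x\<bar> - \<bar>d\<bar>)\<^sup>2 / \<eta>" using assms by simp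
      also have "\<dots> = \<eta> * x\<^sup>2 + d\<^sup>2 / \<eta> - 2 * \<bar>x * d\<bar>"
        using assms by (simp add: power2_diff abs_mult power_mult_distrib field_simps power2_eq_square)
      finally show ?thesis by simp
    qed
    from this[of "X 0 \<omega>" "D \<omega>"]
    have "\<bar>(D \<omega>)\<^sup>2 - 2 * (X 0 \<omega> * D \<omega>)\<bar> \<le> B \<omega>"
      unfolding B_def by (simp add: distrib_right abs_le_iff) (smt (verit) zero_le_power2)
    also have "(D \<omega>)\<^sup>2 - 2 * (X 0 \<omega> * D \<omega>) = (trunc m 0 \<omega>)\<^sup>2 - (X 0 \<omega>)\<^sup>2"
      by (simp add: D_def power2_eq_square algebra_simps)
    finally show ?thesis .
  qed
  have "trunc_var m - 1 = expectation (\<lambda>\<omega>. (trunc m 0 \<omega>)\<^sup>2 - (X 0 \<omega>)\<^sup>2)"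
    by (simp add: X_second_moment trunc_second_moment)
  also have "\<bar>\<dots>\<bar> \<le> expectation (\<lambda>\<omega>. \<bar>(trunc m 0 \<omega>)\<^sup>2 - (X 0 \<omega>)\<^sup>2\<bar>)"
    by (rule integral_abs_bound)
  also have "\<dots> \<le> expectation B"
    using pt by (intro integral_mono B) (auto intro!: integrable_abs X_second_moment trunc_second_moment)
  finally show ?thesis by (simp add: B)
qed

lemma trunc_var_tendsto: "trunc_var \<longlonglongrightarrow> 1"
proof (rule tendstoI)
  fix e :: real assume e: "e > 0"
  have "(\<lambda>m. e / 2 + err m 0 * (1 / (e / 2) + 1)) \<longlonglongrightarrow> e / 2 + 0 * (1 / (e / 2) + 1)"
    by (intro tendsto_intros err_tendsto)
  then have "\<forall>\<^sub>F m in sequentially. e / 2 + err m 0 * (1 / (e / 2) + 1) < e"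
    by (rule order_tendstoD(2)) (use e in simp)
  then show "\<forall>\<^sub>F m in sequentially. dist (trunc_var m) 1 < e"
    by eventually_elim (use trunc_var_deviation[of "e / 2"] e in \<open>auto simp: dist_real_def intro: le_less_trans\<close>)
qed

lemma trunc_var_mono: "mono trunc_var"
  unfolding trunc_var_def by (intro monoI mult_left_mono sum_mono2) auto

lemma trunc_var_le_1: "trunc_var m \<le> 1"
  using incseq_le[OF trunc_var_mono trunc_var_tendsto] .

section \<open>Exceedance probabilities\<close>

text \<open>For N \<ge> m the remainder is a finite normal sum plus the error of the truncation at
  N. The sum has variance \<open>trunc_var N - trunc_var m\<close>, at most \<open>\<delta>\<close>
  for every N because \<open>trunc_var\<close> increases to 1. Each part gets half of
  \<open>t\<close>. The bound is uniform in \<open>i\<close> although \<open>err N i\<close> is only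
  used at fixed \<open>i\<close>.\<close>

lemma remainder_tail:
  assumes d: "1 - trunc_var m \<le> \<delta>" and t: "t > 0"
  shows "prob {\<omega> \<in> space M. \<bar>X i \<omega> - trunc m i \<omega>\<bar> > t} \<le> 2 * exp (- (t / 2)\<^sup>2 / (2 * \<delta>))"
proof -
  let ?c = "2 * exp (- (t / 2)\<^sup>2 / (2 * \<delta>))"
  have bound: "prob {\<omega> \<in> space M. \<bar>X i \<omega> - trunc m i \<omega>\<bar> > t} \<le> ?c + err N i / (t / 2)\<^sup>2"
    if N: "N \<ge> m" for N
  proof -
    have split: "(\<Sum>j\<le>N. f j) = (\<Sum>j\<le>m. f j) + (\<Sum>j\<in>{m<..N}. f j)" for f :: "nat \<Rightarrow> real"
    proof -
      have "{..N} = {..m} \<union> {m<..N}" using N by auto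
      then show ?thesis by (metis sum.union_disjoint finite_atMost finite_greaterThanAtMost ivl_disj_int_one(3))
    qed
    let ?S = "\<lambda>\<omega>. \<Sum>j\<in>{m<..N}. \<psi> j * Z (i - int j) \<omega>"
    have S: "trunc N i \<omega> = trunc m i \<omega> + ?S \<omega>" for \<omega>
      unfolding trunc_def by (rule split)
    have "s\<^sup>2 * (\<Sum>j\<in>{m<..N}. (\<psi> j)\<^sup>2) = trunc_var N - trunc_var m"
      unfolding trunc_var_def split by (simp add: algebra_simps)
    then have v: "s\<^sup>2 * (\<Sum>j\<in>{m<..N}. (\<psi> j)\<^sup>2) \<le> \<delta>"
      using d trunc_var_le_1[of N] by simp
    have "prob {\<omega> \<in> space M. \<bar>X i \<omega> - trunc m i \<omega>\<bar> > t}
        \<le> prob ({\<omega> \<in> space M. \<bar>?S \<omega>\<bar> > t / 2} \<union> {\<omega> \<in> space M. \<bar>X i \<omega> - trunc N i \<omega>\<bar> \<ge> t / 2})"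
      proof (intro finite_measure_mono subsetI)
      fix \<omega> assume "\<omega> \<in> {\<omega> \<in> space M. \<bar>X i \<omega> - trunc m i \<omega>\<bar> > t}"
      moreover have "\<bar>?S \<omega>\<bar> > t / 2 \<or> \<bar>X i \<omega> - trunc N i \<omega>\<bar> \<ge> t / 2" if "\<bar>X i \<omega> - trunc m i \<omega>\<bar> > t"
        using that S[of \<omega>] by linarith
      ultimately show "\<omega> \<in> {\<omega> \<in> space M. \<bar>?S \<omega>\<bar> > t / 2} \<union> {\<omega> \<in> space M. \<bar>X i \<omega> - trunc N i \<omega>\<bar> \<ge> t / 2}"
        by blast
    qed auto
    also have "\<dots> \<le> prob {\<omega> \<in> space M. \<bar>?S \<omega>\<bar> > t / 2} + prob {\<omega> \<in> space M. \<bar>X i \<omega> - trunc N i \<omega>\<bar> \<ge> t / 2}"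
      by (intro measure_Un_le) auto
    also have "\<dots> \<le> ?c + err N i / (t / 2)\<^sup>2"
      unfolding err_def using t v
      by (intro add_mono moving_sum_abs_tail[OF indep_Z normal_Z s_pos] second_moment_method integrable_remainder) auto
    finally show ?thesis .
  qed
  \<comment> \<open>The probability on the left does not involve N, so the limit removes the
    Chebyshev term.\<close>
  have "(\<lambda>N. ?c + err N i / (t / 2)\<^sup>2) \<longlonglongrightarrow> ?c + 0 / (t / 2)\<^sup>2"
    using t by (intro tendsto_intros err_tendsto) auto
  then have "(\<lambda>N. ?c + err N i / (t / 2)\<^sup>2) \<longlonglongrightarrow> ?c" by simp
  then show ?thesis
    using bound by (intro LIMSEQ_le_const) auto
qed

lemma upper_exceedance:
  assumes e: "\<epsilon> > 0"
  shows "(\<lambda>n. prob {\<omega> \<in> space M. \<exists>i\<in>{1..int n}. X i \<omega> > (1 + \<epsilon>) * sqrt (2 * ln (real n))}) \<longlonglongrightarrow> 0"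
proof (rule Lim_null_comparison)
  have "1 < (1 + \<epsilon>)\<^sup>2" using e by (intro one_less_power) auto
  then show "(\<lambda>n. real n * exp (- ((1 + \<epsilon>)\<^sup>2 * (sqrt (2 * ln (real n)))\<^sup>2 / 2))) \<longlonglongrightarrow> 0"
    by (rule upper_rate)
  show "\<forall>\<^sub>F n in sequentially. norm (prob {\<omega> \<in> space M. \<exists>i\<in>{1..int n}. X i \<omega> > (1 + \<epsilon>) * sqrt (2 * ln (real n))})
     \<le> real n * exp (- ((1 + \<epsilon>)\<^sup>2 * (sqrt (2 * ln (real n)))\<^sup>2 / 2))"
    using eventually_gt_at_top[of 0]
  proof eventually_elim
    case (elim n)
    let ?t = "(1 + \<epsilon>) * sqrt (2 * ln (real n))"
    have "?t \<ge> 0" using e elim by simp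
    have "prob {\<omega> \<in> space M. \<exists>i\<in>{1..int n}. X i \<omega> > ?t}
        \<le> real (card {1..int n}) * exp (- ?t\<^sup>2 / (2 * 1\<^sup>2))"
      by (intro prob_Bex_le normal_upper_tail normal_X \<open>?t \<ge> 0\<close>) auto
    then show ?case by (simp only: power_mult_distrib) simp
  qed
qed

text \<open>The constant 32 makes the exponent in \<open>remainder_tail\<close> equal to -L^2 = -2
  ln n for L = sqrt(2 ln n). A single remainder is then too large with probability at most 2/n^2,
  and the union bound leaves 2/n.\<close>

lemma remainder_exceedance:
  assumes e: "\<epsilon> > 0" and d: "1 - trunc_var m \<le> \<epsilon>\<^sup>2 / 32"
  shows "(\<lambda>n. prob {\<omega> \<in> space M. \<exists>i\<in>{1..int n}. \<bar>X i \<omega> - trunc m i \<omega>\<bar> > \<epsilon> / 2 * sqrt (2 * ln (real n))})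
    \<longlonglongrightarrow> 0"
proof (rule Lim_null_comparison)
  have "(\<lambda>n. 2 * (real n * exp (- (2 * (sqrt (2 * ln (real n)))\<^sup>2 / 2)))) \<longlonglongrightarrow> 2 * 0"
    by (intro tendsto_mult_left upper_rate) simp
  then show "(\<lambda>n. 2 * (real n * exp (- (2 * (sqrt (2 * ln (real n)))\<^sup>2 / 2)))) \<longlonglongrightarrow> 0" by simp
  show "\<forall>\<^sub>F n in sequentially. norm (prob {\<omega> \<in> space M. \<exists>i\<in>{1..int n}. \<bar>X i \<omega> - trunc m i \<omega>\<bar> > \<epsilon> / 2 * sqrt (2 * ln (real n))})
     \<le> 2 * (real n * exp (- (2 * (sqrt (2 * ln (real n)))\<^sup>2 / 2)))"
    \<comment> \<open>The case n = 1 is excluded because the level is then 0, while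
      \<open>remainder_tail\<close> needs a positive one.\<close>
    using eventually_gt_at_top[of 1]
  proof eventually_elim
    case (elim n)
    let ?L = "sqrt (2 * ln (real n))"
    have t: "\<epsilon> / 2 * ?L > 0" using e elim by simp
    have "prob {\<omega> \<in> space M. \<exists>i\<in>{1..int n}. \<bar>X i \<omega> - trunc m i \<omega>\<bar> > \<epsilon> / 2 * ?L}
        \<le> real (card {1..int n}) * (2 * exp (- (\<epsilon> / 2 * ?L / 2)\<^sup>2 / (2 * (\<epsilon>\<^sup>2 / 32))))"
      by (intro prob_Bex_le remainder_tail t d) auto
    also have "- (\<epsilon> / 2 * ?L / 2)\<^sup>2 / (2 * (\<epsilon>\<^sup>2 / 32)) = - (2 * ?L\<^sup>2 / 2)"
      using e by (simp only: power_mult_distrib power_divide) simp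
    finally show ?case by simp
  qed
qed

lemma trunc_low_blocks:
  assumes a: "0 < a" "a < sqrt (trunc_var m)"
  shows "(\<lambda>n. prob {\<omega> \<in> space M. \<forall>i\<in>{1..int n}. trunc m i \<omega> \<le> a * sqrt (2 * ln (real n))}) \<longlonglongrightarrow> 0"
proof (rule Lim_null_comparison)
  define p where "p n = normal_density 0 (sqrt (trunc_var m)) (a * sqrt (2 * ln (real n)) + 1)" for n :: nat
  \<comment> \<open>The summand -1 pays for rounding: for k = n div (m + 1), n/(m + 1) \<le> k + 1,
    and \<open>p n \<le> 1\<close>, so k p is at least n p/(m + 1) - 1.\<close>
  have "filterlim (\<lambda>n::nat. -1 + real n * (1 / real (m + 1)) * p n) at_top sequentially"
    unfolding p_def by (intro filterlim_tendsto_add_at_top[OF tendsto_const] lower_rate a) auto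
  then have "filterlim (\<lambda>n::nat. - (-1 + real n * (1 / real (m + 1)) * p n)) at_bot sequentially"
    by (simp only: filterlim_uminus_at_top)
  then show "(\<lambda>n::nat. exp (- (-1 + real n * (1 / real (m + 1)) * p n))) \<longlonglongrightarrow> 0"
    by (rule filterlim_compose[OF exp_at_bot])
  show "\<forall>\<^sub>F n in sequentially. norm (prob {\<omega> \<in> space M. \<forall>i\<in>{1..int n}. trunc m i \<omega> \<le> a * sqrt (2 * ln (real n))})
      \<le> exp (- (-1 + real n * (1 / real (m + 1)) * p n))"
    using eventually_gt_at_top[of 0]
  proof eventually_elim
    case (elim n)
    define k where "k = n div (m + 1)"
    let ?t = "a * sqrt (2 * ln (real n))"
    let ?g = "\<lambda>q::nat. int (m + 1) * int q"
    have t: "?t \<ge> 0" using a elim by simp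
    have s: "sqrt (trunc_var m) > 0" using trunc_var_pos by simp
    have p: "p n \<le> prob {\<omega> \<in> space M. trunc m i \<omega> > ?t}" for i
      unfolding p_def by (rule normal_lower_tail[OF normal_trunc s t])
    then have p1: "p n \<le> 1" by (meson order_trans prob_le_1)
    have p0: "p n \<ge> 0" by (simp add: p_def)
    \<comment> \<open>Distinct multiples of m + 1 differ by at least m + 1, but the offsets
      \<open>j\<close> and \<open>l\<close> differ by at most m.\<close>
    have "?g q - int j \<noteq> ?g r - int l" if "j \<le> m" "l \<le> m" "q \<noteq> r" for q r j l
    proof
      assume "?g q - int j = ?g r - int l"
      then have "int (m + 1) * (int q - int r) = int j - int l" by (simp add: algebra_simps)
      moreover have "\<bar>int j - int l\<bar> < int (m + 1)" using that by auto
      moreover have "\<bar>int q - int r\<bar> \<ge> 1" using that by auto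
      then have "int (m + 1) * 1 \<le> int (m + 1) * \<bar>int q - int r\<bar>" by (intro mult_left_mono) auto
      then have "int (m + 1) \<le> \<bar>int (m + 1) * (int q - int r)\<bar>" by (simp add: abs_mult)
      ultimately show False by simp
    qed
    then have "disjoint_family_on (\<lambda>q. (\<lambda>j. ?g q - int j) ` {..m}) {1..k}"
      unfolding disjoint_family_on_def by blast
    then have ind: "indep_vars (\<lambda>_. borel) (\<lambda>q. trunc m (?g q)) {1..k}"
      unfolding trunc_def[abs_def] by (rule indep_vars_shifted_sums[OF indep_Z])
    have k: "int (m + 1) * int q \<in> {1..int n}" if "q \<in> {1..k}" for q
    proof -
      have "(m + 1) * q \<le> (m + 1) * k" using that by (intro mult_left_mono) auto
      also have "\<dots> \<le> n" unfolding k_def by (rule times_div_less_eq_dividend)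
      finally have "int ((m + 1) * q) \<le> int n" by (simp only: of_nat_le_iff)
      moreover have "(m + 1) * q \<ge> 1" using that by (simp add: Suc_le_eq)
      then have "int ((m + 1) * q) \<ge> 1" by linarith
      ultimately show ?thesis by (simp only: of_nat_mult atLeastAtMost_iff)
    qed
    have "prob {\<omega> \<in> space M. \<forall>i\<in>{1..int n}. trunc m i \<omega> \<le> ?t}
        \<le> prob {\<omega> \<in> space M. \<forall>q\<in>{1..k}. trunc m (?g q) \<omega> \<le> ?t}"
      using k by (intro finite_measure_mono) auto
    also have "\<dots> \<le> exp (- p n * card {1..k})"
      by (intro prob_Ball_le_indep ind p) auto
    also have "\<dots> \<le> exp (- (-1 + real n * (1 / real (m + 1)) * p n))"
    proof -
      have "real n * (1 / real (m + 1)) \<le> real k + 1"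
      proof -
        have "n \<le> (k + 1) * (m + 1)"
          using dividend_less_div_times[of "m + 1" n] by (simp add: k_def)
        then have "real n \<le> real ((k + 1) * (m + 1))" by (simp only: of_nat_le_iff)
        then show ?thesis by (simp only: of_nat_mult) (simp add: pos_divide_le_eq add.commute)
      qed
      then have "real n * (1 / real (m + 1)) * p n \<le> (real k + 1) * p n"
        using p0 by (rule mult_right_mono)
      then show ?thesis using p1 by (simp add: algebra_simps)
    qed
    finally show ?case by simp
  qed
qed

text \<open>One \<open>m\<close> serves twice: its variance bound makes the remainders small and
  also puts the standard deviation of the truncation above 1 - \<epsilon>/2. If every X is below (1
  - \<epsilon>) L and no remainder exceeds (\<epsilon>/2) L, every truncation is below (1 -
  \<epsilon>/2) L.\<close>

lemma lower_exceedance: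
  assumes e: "0 < \<epsilon>" "\<epsilon> < 1"
  shows "(\<lambda>n. prob {\<omega> \<in> space M. \<forall>i\<in>{1..int n}. X i \<omega> \<le> (1 - \<epsilon>) * sqrt (2 * ln (real n))}) \<longlonglongrightarrow> 0"
proof -
  have "\<forall>\<^sub>F m in sequentially. trunc_var m > 1 - \<epsilon>\<^sup>2 / 32"
    using e by (intro order_tendstoD(1)[OF trunc_var_tendsto]) auto
  then obtain m where m: "trunc_var m > 1 - \<epsilon>\<^sup>2 / 32"
    by (metis eventually_sequentially order_refl)
  have "(1 - \<epsilon> / 2)\<^sup>2 = 1 - \<epsilon> + \<epsilon>\<^sup>2 / 4"
    by (simp add: power2_eq_square algebra_simps)
  moreover have "\<epsilon>\<^sup>2 < \<epsilon>" using e by (simp add: power2_eq_square)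
  ultimately have "(1 - \<epsilon> / 2)\<^sup>2 < trunc_var m" using m e by linarith
  then have a: "1 - \<epsilon> / 2 < sqrt (trunc_var m)" by (rule real_less_rsqrt)
  show ?thesis
  proof (rule Lim_null_comparison)
    let ?A = "\<lambda>n. {\<omega> \<in> space M. \<forall>i\<in>{1..int n}. trunc m i \<omega> \<le> (1 - \<epsilon> / 2) * sqrt (2 * ln (real n))}"
    let ?B = "\<lambda>n. {\<omega> \<in> space M. \<exists>i\<in>{1..int n}. \<bar>X i \<omega> - trunc m i \<omega>\<bar> > \<epsilon> / 2 * sqrt (2 * ln (real n))}"
    show "(\<lambda>n. prob (?A n) + prob (?B n)) \<longlonglongrightarrow> 0"
      using a m e by (intro tendsto_add_zero trunc_low_blocks remainder_exceedance) auto
    show "\<forall>\<^sub>F n in sequentially. norm (prob {\<omega> \<in> space M. \<forall>i\<in>{1..int n}. X i \<omega> \<le> (1 - \<epsilon>) * sqrt (2 * ln (real n))})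
        \<le> prob (?A n) + prob (?B n)"
    proof (intro always_eventually allI)
      fix n
      have "{\<omega> \<in> space M. \<forall>i\<in>{1..int n}. X i \<omega> \<le> (1 - \<epsilon>) * sqrt (2 * ln (real n))} \<subseteq> ?A n \<union> ?B n"
      proof (safe, rule ccontr)
        fix \<omega> i assume *: "\<forall>i\<in>{1..int n}. X i \<omega> \<le> (1 - \<epsilon>) * sqrt (2 * ln (real n))"
          "\<not> (\<exists>i\<in>{1..int n}. \<bar>X i \<omega> - trunc m i \<omega>\<bar> > \<epsilon> / 2 * sqrt (2 * ln (real n)))"
          "i \<in> {1..int n}" "\<not> trunc m i \<omega> \<le> (1 - \<epsilon> / 2) * sqrt (2 * ln (real n))"
        then have "X i \<omega> \<le> (1 - \<epsilon>) * sqrt (2 * ln (real n))"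
          "\<bar>X i \<omega> - trunc m i \<omega>\<bar> \<le> \<epsilon> / 2 * sqrt (2 * ln (real n))" by (blast, meson not_less)
        then have "trunc m i \<omega> \<le> (1 - \<epsilon>) * sqrt (2 * ln (real n)) + \<epsilon> / 2 * sqrt (2 * ln (real n))"
          by linarith
        also have "\<dots> = (1 - \<epsilon> / 2) * sqrt (2 * ln (real n))" by (simp add: algebra_simps)
        finally show False using *(4) by contradiction
      qed
      then have "prob {\<omega> \<in> space M. \<forall>i\<in>{1..int n}. X i \<omega> \<le> (1 - \<epsilon>) * sqrt (2 * ln (real n))} \<le> prob (?A n \<union> ?B n)"
        by (intro finite_measure_mono) auto
      also have "\<dots> \<le> prob (?A n) + prob (?B n)"
        by (intro measure_Un_le) auto
      finally show "norm (prob {\<omega> \<in> space M. \<forall>i\<in>{1..int n}. X i \<omega> \<le> (1 - \<epsilon>) * sqrt (2 * ln (real n))})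
        \<le> prob (?A n) + prob (?B n)" by simp
    qed
  qed
qed

lemma running_max_converges:
  "converges_in_probability M (\<lambda>n \<omega>. running_max X n \<omega> / sqrt (2 * ln (real n))) (\<lambda>_. 1)"
  unfolding converges_in_probability_def
proof (intro conjI allI impI)
  have rm [measurable]: "running_max X n \<in> borel_measurable M" for n
    unfolding running_max_def[abs_def] by (intro borel_measurable_Max) auto
  show "(\<lambda>\<omega>. running_max X n \<omega> / sqrt (2 * ln (real n))) \<in> borel_measurable M" for n
    by measurable
  fix e :: real assume "e > 0"
  \<comment> \<open>The cap 1/2 meets the condition \<open>\<epsilon> < 1\<close> of
    \<open>lower_exceedance\<close>; shrinking the tolerance only enlarges the deviation
    event.\<close>
  define \<epsilon> where "\<epsilon> = min e (1 / 2)"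
  have e: "0 < \<epsilon>" "\<epsilon> < 1" "\<epsilon> \<le> e" using \<open>e > 0\<close> by (auto simp: \<epsilon>_def)
  let ?A = "\<lambda>n. {\<omega> \<in> space M. \<exists>i\<in>{1..int n}. X i \<omega> > (1 + \<epsilon>) * sqrt (2 * ln (real n))}"
  let ?B = "\<lambda>n. {\<omega> \<in> space M. \<forall>i\<in>{1..int n}. X i \<omega> \<le> (1 - \<epsilon>) * sqrt (2 * ln (real n))}"
  let ?E = "\<lambda>n. {\<omega> \<in> space M. \<bar>running_max X n \<omega> / sqrt (2 * ln (real n)) - 1\<bar> > e}"
  show "(\<lambda>n. prob (?E n)) \<longlonglongrightarrow> 0"
  proof (rule Lim_null_comparison)
    show "(\<lambda>n. prob (?A n) + prob (?B n)) \<longlonglongrightarrow> 0"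
      by (intro tendsto_add_zero upper_exceedance lower_exceedance e)
    show "\<forall>\<^sub>F n in sequentially. norm (prob (?E n)) \<le> prob (?A n) + prob (?B n)"
      using eventually_gt_at_top[of 1]
    proof eventually_elim
      case (elim n)
      define L where "L = sqrt (2 * ln (real n))"
      have L: "L > 0" using elim by (simp add: L_def)
      have "?E n \<subseteq> ?A n \<union> ?B n"
      proof
        fix \<omega> assume \<omega>: "\<omega> \<in> ?E n"
        define R where "R = running_max X n \<omega>"
        have ne: "{1..int n} \<noteq> {}" using elim by auto
        have "\<bar>R / L - 1\<bar> > \<epsilon>" using \<omega> e by (simp add: R_def L_def)
        then have "R / L > 1 + \<epsilon> \<or> R / L \<le> 1 - \<epsilon>" by linarith
        then have "R > (1 + \<epsilon>) * L \<or> R \<le> (1 - \<epsilon>) * L"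
          using L by (simp add: pos_less_divide_eq pos_divide_le_eq)
        moreover have "R > (1 + \<epsilon>) * L \<longleftrightarrow> (\<exists>i\<in>{1..int n}. X i \<omega> > (1 + \<epsilon>) * L)"
          unfolding R_def running_max_def using ne by (subst Max_gr_iff) auto
        moreover have "R \<le> (1 - \<epsilon>) * L \<longleftrightarrow> (\<forall>i\<in>{1..int n}. X i \<omega> \<le> (1 - \<epsilon>) * L)"
          unfolding R_def running_max_def using ne by (subst Max_le_iff) auto
        ultimately show "\<omega> \<in> ?A n \<union> ?B n" using \<omega> unfolding L_def by auto
      qed
      then have "prob (?E n) \<le> prob (?A n \<union> ?B n)"
        by (intro finite_measure_mono) auto
      also have "\<dots> \<le> prob (?A n) + prob (?B n)"
        by (intro measure_Un_le) auto
      finally show ?case by simp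
    qed
  qed
qed simp

end

section \<open>Reduction of the theorem to the linear process\<close>

text \<open>A centered Gaussian law is determined by its second moment, so knowing that moment
  selects the alternative in \<open>gaussian_rv\<close>.\<close>

lemma (in prob_space) centered_gaussian_rv_cases:
  assumes Y: "gaussian_rv M Y" and mean: "expectation Y = 0"
  obtains (normal) "expectation (\<lambda>\<omega>. (Y \<omega>)\<^sup>2) > 0"
      "distributed M lborel Y (normal_density 0 (sqrt (expectation (\<lambda>\<omega>. (Y \<omega>)\<^sup>2))))"
    | (zero) "expectation (\<lambda>\<omega>. (Y \<omega>)\<^sup>2) = 0" "AE \<omega> in M. Y \<omega> = 0"
proof -
  have [measurable]: "Y \<in> borel_measurable M" using Y by (simp add: gaussian_rv_def)
  from Y consider (n) \<mu> \<sigma> where "\<sigma> > 0" "distributed M lborel Y (normal_density \<mu> \<sigma>)"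
    | (c) \<mu> where "AE \<omega> in M. Y \<omega> = \<mu>"
    unfolding gaussian_rv_def by auto
  then show ?thesis
  proof cases
    case n
    then have "\<mu> = 0" using normal_distributed_expectation mean by metis
    with n have d: "distributed M lborel Y (normal_density 0 \<sigma>)" by simp
    show ?thesis
      using normal normal_second_moment(2)[OF d] d n(1) by simp
  next
    case c
    have "expectation Y = expectation (\<lambda>_. \<mu>)"
      using c by (intro integral_cong_AE) auto
    then have "\<mu> = 0" using mean by (simp add: prob_space)
    with c have ae: "AE \<omega> in M. Y \<omega> = 0" by simp
    then have "expectation (\<lambda>\<omega>. (Y \<omega>)\<^sup>2) = expectation (\<lambda>_. 0)"
      by (intro integral_cong_AE) auto
    then show ?thesis using zero ae by simp
  qed
qed

theorem mainTheorem3: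
  fixes M :: "'a measure" and X :: "int \<Rightarrow> 'a \<Rightarrow> real"
  assumes "prob_space M"
    and "gaussian_process M X"
    and "stationary_process M X"
    and "purely_nondeterministic M X"
    and "\<And>i. prob_space.expectation M (X i) = 0"
    and "\<And>i. prob_space.variance M (X i) = 1"
  shows "converges_in_probability M
           (\<lambda>n \<omega>. running_max X n \<omega> / sqrt (2 * ln (real n))) (\<lambda>_. 1)"
proof -
  interpret prob_space M by fact
  define Z where "Z = innovation M X"
  obtain \<psi> :: "nat \<Rightarrow> real" where indep: "indep_vars (\<lambda>_. borel) Z UNIV"
    and dist: "\<And>i. distr M borel (Z i) = distr M borel (Z 0)"
    and gZ: "\<And>i. gaussian_rv M (Z i)"
    and lim: "\<And>i. (\<lambda>m. \<integral>\<^sup>+ \<omega>. ennreal ((X i \<omega> - (Z i \<omega> + (\<Sum>j=1..m. \<psi> j * Z (i - int j) \<omega>)))\<^sup>2) \<partial>M)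
             \<longlonglongrightarrow> 0"
    using assms(4) unfolding purely_nondeterministic_def Let_def Z_def[symmetric] by blast
  have gX: "gaussian_rv M (X i)" for i
    using assms(2)[unfolded gaussian_process_def, rule_format, of "{i}" "\<lambda>_. 1"] by simp
  have mX [measurable]: "X i \<in> borel_measurable M" for i
    using gX by (simp add: gaussian_rv_def)
  have mZ [measurable]: "Z i \<in> borel_measurable M" for i
    using gZ by (simp add: gaussian_rv_def)
  have X2: "expectation (\<lambda>\<omega>. (X i \<omega>)\<^sup>2) = 1" for i
    using assms(6)[of i] by (simp add: assms(5))
  have nX: "distributed M lborel (X i) std_normal_density" for i
    by (rule centered_gaussian_rv_cases[OF gX[of i] assms(5)[of i]]) (simp_all only: X2 real_sqrt_one zero_neq_one)
  have iX: "integrable M (X i)" for i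
    by (rule square_integrable_imp_integrable[OF mX normal_second_moment(1)[OF nX]]) simp
  \<comment> \<open>Conditional expectation preserves the mean, so the innovation is centered;
    \<open>gaussian_rv\<close> itself allows any mean.\<close>
  have EZ: "expectation (Z i) = 0" for i
  proof -
    interpret F: finite_measure_subalgebra M "strict_past M X i"
      by unfold_locales (intro subalgebra_strict_past mX)
    show ?thesis
      unfolding Z_def innovation_def
      using F.real_cond_exp_int[OF iX[of i]] iX[of i] assms(5)[of i] by simp
  qed
  define v where "v = expectation (\<lambda>\<omega>. (Z 0 \<omega>)\<^sup>2)"
  have v: "expectation (\<lambda>\<omega>. (Z i \<omega>)\<^sup>2) = v" for i
  proof -
    have "expectation (\<lambda>\<omega>. (Z i \<omega>)\<^sup>2) = (\<integral>x. x\<^sup>2 \<partial>distr M borel (Z i))"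
      by (simp add: integral_distr)
    also have "\<dots> = (\<integral>x. x\<^sup>2 \<partial>distr M borel (Z 0))" by (simp only: dist[of i])
    also have "\<dots> = v" unfolding v_def by (simp add: integral_distr)
    finally show ?thesis .
  qed
  \<comment> \<open>If the innovations vanished almost surely, all partial sums would too, and the
    mean-square error would stay at E X^2 = 1 instead of tending to 0.\<close>
  have "v \<noteq> 0"
  proof
    assume "v = 0"
    have "AE \<omega> in M. Z i \<omega> = 0" for i
      by (rule centered_gaussian_rv_cases[OF gZ[of i] EZ[of i]]) (simp_all only: v \<open>v = 0\<close> less_irrefl)
    then have "AE \<omega> in M. \<forall>i. Z i \<omega> = 0" by (simp add: AE_all_countable)
    then have "(\<integral>\<^sup>+ \<omega>. ennreal ((X 0 \<omega> - (Z 0 \<omega> + (\<Sum>j=1..m. \<psi> j * Z (0 - int j) \<omega>)))\<^sup>2) \<partial>M)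
        = (\<integral>\<^sup>+ \<omega>. ennreal ((X 0 \<omega>)\<^sup>2) \<partial>M)" for m
      by (intro nn_integral_cong_AE) auto
    also have "\<dots> = 1"
      using nn_integral_eq_integral[OF normal_second_moment(1)[OF nX[of 0]]] X2[of 0] by simp
    finally show False using lim[of 0] by (simp add: LIMSEQ_const_iff)
  qed
  have nZ: "distributed M lborel (Z i) (normal_density 0 (sqrt v)) \<and> v > 0" for i
    by (rule centered_gaussian_rv_cases[OF gZ[of i] EZ[of i]]) (use \<open>v \<noteq> 0\<close> in \<open>simp_all only: v simp_thms\<close>)
  \<comment> \<open>The separate innovation \<open>Z i\<close> becomes the term of index 0 with
    coefficient 1, which also supplies \<open>psi_0\<close>.\<close>
  define \<psi>' where "\<psi>' j = (if j = 0 then 1 else \<psi> j)" for j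
  have "(\<Sum>j\<le>m. \<psi>' j * Z (i - int j) \<omega>) = Z i \<omega> + (\<Sum>j=1..m. \<psi> j * Z (i - int j) \<omega>)" for i m \<omega>
  proof -
    have "{..m} = insert 0 {1..m}" by auto
    then show ?thesis by (simp add: \<psi>'_def)
  qed
  then interpret gaussian_linear_process M X Z \<psi>' "sqrt v"
    using indep nZ nX lim by unfold_locales (simp_all add: \<psi>'_def)
  show ?thesis by (rule running_max_converges)
qed

end
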